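(* Let $\Gamma_A$ and $\Gamma_B$ be $n$-coloured simplicial complexes, and let $\Omega_A$ and $\Omega_B$ be smartly paired non-zero cycles ($\mathbb Z_2$-coefficients) in $\Gamma_A$ and $\Gamma_B$, of dimension $d_A$ and $d_B$ respectively. Then they define a non-zero $(d_A+d_B+2-n)$-cycle $X(\Omega_A,\Omega_B)$ in $X_{\Gamma_A,\Gamma_B}$ (with $\mathbb Z_2$-coefficients).
   Context: All simplicial complexes are finite, and the empty set counts as a simplex (of dimension $-1$) of every complex. An $n$-coloured simplicial complex is a simplicial complex whose vertex set is partitioned into $n$ labelled (possibly empty) classes, the colours $1,\dots,n$, so that adjacent vertices have different colours. Let $\Gamma_A,\Gamma_B$ be $n$-coloured with colour classes $A_1,\dots,A_n$ and $B_1,\dots,B_n$. Simplices $\mathfrak a\subseteq\Gamma_A$, $\mathfrak b\subseteq\Gamma_B$ (possibly empty) are complementary if for each $i$ exactly one of $\mathfrak a,\mathfrak b$ has a vertex of colour $i$. Let $K=\prod_{i=1}^n (A_i*B_i)$, a product of complete bipartite graphs, viewed as a cube complex. A vertex $(x_1,\dots,x_n)$ of $K$, $x_i\in A_i\sqcup B_i$, is identified with the pair $(\mathfrak a,\mathfrak b)$, $\mathfrak a=\{x_i: x_i\in A_i\}$, $\mathfrak b=\{x_i: x_i\in B_i\}$. The coupled link cube complex $X_{\Gamma_A,\Gamma_B}$ is the full subcomplex of $K$ (all cubes all of whose vertices belong to it) on the vertices $(\mathfrak a,\mathfrak b)$ such that $\mathfrak a$ is a simplex of $\Gamma_A$ and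 $\mathfrak b$ is a simplex of $\Gamma_B$. Chains and cycles are cellular/simplicial with $\mathbb Z_2$-coefficients; the boundary of a cube (simplex) is the sum of its codimension-one faces, and complexes are augmented (reduced homology). The support of a $k$-chain is the subcomplex given by the union of the $k$-simplices with non-zero coefficient. A $d_A$-chain $\Omega_A$ in $\Gamma_A$ and a $d_B$-chain $\Omega_B$ in $\Gamma_B$ are smartly paired if every $d_A$-simplex in the support $\chi_A$ of $\Omega_A$ has a complementary simplex in the support $\chi_B$ of $\Omega_B$, and every $d_B$-simplex in $\chi_B$ has a complementary simplex in $\chi_A$. In that case $X(\Omega_A,\Omega_B)$ is the sum of all $(d_A+d_B+2-n)$-dimensional cubes of $X_{\chi_A,\chi_B}\subseteq X_{\Gamma_A,\Gamma_B}$, where $\chi_A,\chi_B$ carry the restricted colourings. *)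

theory Defs
  imports "HOL-Library.FuncSet" "HOL-Library.Disjoint_Sets" "HOL-Library.Poly_Mapping" "HOL-Library.Z2"
begin

text \<open>
  Simplices and cubes are both represented by their vertex sets, so that the face relation is
  inclusion. A complex is a set \<open>C\<close> of cells together with a dimension function \<open>dm\<close>. It is
  augmented precisely if the empty cell, of dimension \<open>-1\<close>, belongs to \<open>C\<close>; the coefficient of the
  empty cell in the boundary of a 0-chain is then its augmentation.
\<close>

type_synonym 'v chain = "'v set \<Rightarrow>\<^sub>0 bit"

definition cells :: "'v set set \<Rightarrow> ('v set \<Rightarrow> int) \<Rightarrow> int \<Rightarrow> 'v set set" where
  "cells C dm k = {\<sigma> \<in> C. dm \<sigma> = k}"

definition facets :: "'v set set \<Rightarrow> ('v set \<Rightarrow> int) \<Rightarrow> 'v set \<Rightarrow> 'v set set" where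
  "facets C dm \<sigma> = {\<tau> \<in> C. \<tau> \<subseteq> \<sigma> \<and> dm \<tau> = dm \<sigma> - 1}"

definition sum_of_cells :: "'v set set \<Rightarrow> 'v chain" where
  "sum_of_cells S = (\<Sum>\<sigma>\<in>S. Poly_Mapping.single \<sigma> 1)"

text \<open>A key of a chain has coefficient 1, so no coefficient appears in the sum.\<close>

definition boundary :: "'v set set \<Rightarrow> ('v set \<Rightarrow> int) \<Rightarrow> 'v chain \<Rightarrow> 'v chain" where
  "boundary C dm \<Omega> = (\<Sum>\<sigma>\<in>Poly_Mapping.keys \<Omega>. sum_of_cells (facets C dm \<sigma>))"

definition chains :: "'v set set \<Rightarrow> ('v set \<Rightarrow> int) \<Rightarrow> int \<Rightarrow> 'v chain set" where
  "chains C dm k = {\<Omega>. Poly_Mapping.keys \<Omega> \<subseteq> cells C dm k}"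

definition cycles :: "'v set set \<Rightarrow> ('v set \<Rightarrow> int) \<Rightarrow> int \<Rightarrow> 'v chain set" where
  "cycles C dm k = {\<Omega> \<in> chains C dm k. boundary C dm \<Omega> = 0}"

definition simplicial_complex :: "'v set set \<Rightarrow> bool" where
  "simplicial_complex \<Gamma> \<longleftrightarrow> finite \<Gamma> \<and> (\<forall>\<sigma>\<in>\<Gamma>. finite \<sigma>) \<and> {} \<in> \<Gamma> \<and>
     (\<forall>\<sigma>\<in>\<Gamma>. \<forall>\<tau>. \<tau> \<subseteq> \<sigma> \<longrightarrow> \<tau> \<in> \<Gamma>)"

definition sdim :: "'v set \<Rightarrow> int" where
  "sdim \<sigma> = int (card \<sigma>) - 1"

definition coloured_complex :: "nat \<Rightarrow> 'v set set \<Rightarrow> (nat \<Rightarrow> 'v set) \<Rightarrow> bool" where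
  "coloured_complex n \<Gamma> A \<longleftrightarrow> simplicial_complex \<Gamma> \<and>
     disjoint_family_on A {1..n} \<and> (\<Union>i\<in>{1..n}. A i) = \<Union>\<Gamma> \<and>
     (\<forall>u v. {u, v} \<in> \<Gamma> \<and> u \<noteq> v \<longrightarrow> (\<forall>i\<in>{1..n}. \<not> (u \<in> A i \<and> v \<in> A i)))"

definition complementary ::
    "nat \<Rightarrow> (nat \<Rightarrow> 'a set) \<Rightarrow> (nat \<Rightarrow> 'b set) \<Rightarrow> 'a set \<Rightarrow> 'b set \<Rightarrow> bool" where
  "complementary n A B \<aa> \<bb> \<longleftrightarrow> (\<forall>i\<in>{1..n}. (\<aa> \<inter> A i \<noteq> {}) \<noteq> (\<bb> \<inter> B i \<noteq> {}))"

text \<open>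
  The support of the zero chain is empty, which differs from the support of the (-1)-chain
  given by the empty simplex.
\<close>

definition chain_support :: "'v chain \<Rightarrow> 'v set set" where
  "chain_support \<Omega> = {\<tau>. \<exists>\<sigma>\<in>Poly_Mapping.keys \<Omega>. \<tau> \<subseteq> \<sigma>}"

definition smartly_paired :: "nat \<Rightarrow> (nat \<Rightarrow> 'a set) \<Rightarrow> (nat \<Rightarrow> 'b set) \<Rightarrow>
    int \<Rightarrow> int \<Rightarrow> 'a chain \<Rightarrow> 'b chain \<Rightarrow> bool" where
  "smartly_paired n A B dA dB \<Omega>A \<Omega>B \<longleftrightarrow>
     (\<forall>\<aa> \<in> cells (chain_support \<Omega>A) sdim dA. \<exists>\<bb> \<in> chain_support \<Omega>B. complementary n A B \<aa> \<bb>) \<and>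
     (\<forall>\<bb> \<in> cells (chain_support \<Omega>B) sdim dB. \<exists>\<aa> \<in> chain_support \<Omega>A. complementary n A B \<aa> \<bb>)"

text \<open>The non-empty cells (vertices and edges) of the complete bipartite graph \<open>P * Q\<close>.\<close>

definition join_cells :: "'a set \<Rightarrow> 'b set \<Rightarrow> ('a + 'b) set set" where
  "join_cells P Q = {{x} |x. x \<in> P <+> Q} \<union> {{Inl a, Inr b} |a b. a \<in> P \<and> b \<in> Q}"

definition product_cubes ::
    "nat \<Rightarrow> (nat \<Rightarrow> 'a set) \<Rightarrow> (nat \<Rightarrow> 'b set) \<Rightarrow> (nat \<Rightarrow> 'a + 'b) set set" where
  "product_cubes n A B = {PiE {1..n} c |c. \<forall>i\<in>{1..n}. c i \<in> join_cells (A i) (B i)}"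

text \<open>
  For a non-empty cube this counts the coordinates that are not constant on it, that is, the factors
  that are edges.
\<close>

definition cdim :: "(nat \<Rightarrow> 'v) set \<Rightarrow> int" where
  "cdim Q = (if Q = {} then -1 else int (card {i. \<exists>x\<in>Q. \<exists>y\<in>Q. x i \<noteq> y i}))"

definition A_part :: "nat \<Rightarrow> (nat \<Rightarrow> 'a + 'b) \<Rightarrow> 'a set" where
  "A_part n x = {a. \<exists>i\<in>{1..n}. x i = Inl a}"

definition B_part :: "nat \<Rightarrow> (nat \<Rightarrow> 'a + 'b) \<Rightarrow> 'b set" where
  "B_part n x = {b. \<exists>i\<in>{1..n}. x i = Inr b}"

definition coupled_vertices :: "nat \<Rightarrow> 'a set set \<Rightarrow> (nat \<Rightarrow> 'a set) \<Rightarrow>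
    'b set set \<Rightarrow> (nat \<Rightarrow> 'b set) \<Rightarrow> (nat \<Rightarrow> 'a + 'b) set" where
  "coupled_vertices n \<Gamma>A A \<Gamma>B B =
     {x \<in> (\<Pi>\<^sub>E i\<in>{1..n}. A i <+> B i). A_part n x \<in> \<Gamma>A \<and> B_part n x \<in> \<Gamma>B}"

text \<open>
  The empty cube is left out here and has to be inserted for the augmented complex: a simplicial
  complex always contains the empty simplex, whereas for \<open>n = 0\<close> the cube complex is a single
  point, whose only vertex is a cycle only without augmentation.
\<close>

definition coupled_link :: "nat \<Rightarrow> 'a set set \<Rightarrow> (nat \<Rightarrow> 'a set) \<Rightarrow>
    'b set set \<Rightarrow> (nat \<Rightarrow> 'b set) \<Rightarrow> (nat \<Rightarrow> 'a + 'b) set set" where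
  "coupled_link n \<Gamma>A A \<Gamma>B B =
     {Q \<in> product_cubes n A B. Q \<subseteq> coupled_vertices n \<Gamma>A A \<Gamma>B B}"

definition coupled_chain :: "nat \<Rightarrow> (nat \<Rightarrow> 'a set) \<Rightarrow> (nat \<Rightarrow> 'b set) \<Rightarrow>
    int \<Rightarrow> int \<Rightarrow> 'a chain \<Rightarrow> 'b chain \<Rightarrow> (nat \<Rightarrow> 'a + 'b) chain" where
  "coupled_chain n A B dA dB \<Omega>A \<Omega>B =
     (let \<chi>A = chain_support \<Omega>A; \<chi>B = chain_support \<Omega>B in
      sum_of_cells (cells (coupled_link n \<chi>A (\<lambda>i. A i \<inter> \<Union>\<chi>A) \<chi>B (\<lambda>i. B i \<inter> \<Union>\<chi>B))
        cdim (dA + dB + 2 - int n)))"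

end

theory Submission
  imports Defs
begin

text \<open>
  A cube of the coupled link complex is the same as a pair \<open>(\<aa>, \<bb>)\<close> of simplices whose colours
  together exhaust \<open>1, \<dots>, n\<close>; its dimension is \<open>card \<aa> + card \<bb> - n\<close> and its faces are the
  pairs of faces that still exhaust the colours. Hence the cubes of \<open>X(\<Omega>A, \<Omega>B)\<close> are the exhausting
  pairs of top simplices of the two chains, and the cubes containing a codimension-one face
  \<open>(\<aa>, \<bb>)\<close> form a product of the sets of top simplices containing \<open>\<aa>\<close> and \<open>\<bb>\<close>, one factor of
  which is even because \<open>\<Omega>A\<close> and \<open>\<Omega>B\<close> are cycles. The augmentation of a 0-chain is treated by
  counting pairs that exhaust all colours except one.
\<close>

definition colours :: "nat \<Rightarrow> (nat \<Rightarrow> 'a set) \<Rightarrow> 'a set \<Rightarrow> nat set" where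
  "colours n A \<aa> = {i\<in>{1..n}. \<aa> \<inter> A i \<noteq> {}}"

text \<open>A colour missing from both simplices leaves an empty factor, so the product is empty
  unless the pair exhausts the colours. For simplices, every non-empty factor is a vertex or an edge
  of the complete bipartite graph.\<close>

definition coupled_cube ::
    "nat \<Rightarrow> (nat \<Rightarrow> 'a set) \<Rightarrow> (nat \<Rightarrow> 'b set) \<Rightarrow> 'a set \<Rightarrow> 'b set \<Rightarrow> (nat \<Rightarrow> 'a + 'b) set" where
  "coupled_cube n A B \<aa> \<bb> = (\<Pi>\<^sub>E i\<in>{1..n}. Inl ` (\<aa> \<inter> A i) \<union> Inr ` (\<bb> \<inter> B i))"

text \<open>In contrast to complementary simplices, the two may share colours; the shared ones are
  the edge directions of the cube. Both the whole complexes and the top simplices of the chains get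
  inserted for \<open>S\<close> and \<open>T\<close>.\<close>

definition spanning_pairs :: "nat \<Rightarrow> (nat \<Rightarrow> 'a set) \<Rightarrow> (nat \<Rightarrow> 'b set) \<Rightarrow>
    'a set set \<Rightarrow> 'b set set \<Rightarrow> ('a set \<times> 'b set) set" where
  "spanning_pairs n A B S T = {(\<aa>, \<bb>) \<in> S \<times> T. {1..n} \<subseteq> colours n A \<aa> \<union> colours n B \<bb>}"

subsection \<open>Chains over the two-element field\<close>

lemma lookup_sum_of_cells:
  "finite S \<Longrightarrow> Poly_Mapping.lookup (sum_of_cells S) \<tau> = of_bool (\<tau> \<in> S)"
  unfolding sum_of_cells_def lookup_sum
  by (simp add: lookup_single when_def of_bool_def)

lemma keys_sum_of_cells: "finite S \<Longrightarrow> Poly_Mapping.keys (sum_of_cells S) = S"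
  by (auto simp: in_keys_iff lookup_sum_of_cells)

lemma lookup_boundary:
  assumes "finite C"
  shows "Poly_Mapping.lookup (boundary C dm \<Omega>) \<tau> =
    of_nat (card {\<sigma> \<in> Poly_Mapping.keys \<Omega>. \<tau> \<in> facets C dm \<sigma>})"
proof -
  have "finite (facets C dm \<sigma>)" for \<sigma>
    using assms by (simp add: facets_def)
  then show ?thesis
    unfolding boundary_def lookup_sum
    by (simp add: lookup_sum_of_cells Int_def)
qed

lemma of_nat_bit_eq_0_iff: "(of_nat m :: bit) = 0 \<longleftrightarrow> even m"
  by (induction m) auto

text \<open>A coefficient of a boundary is a number of cofaces mod 2, so being a cycle is a parity
  condition and the later arguments only count finite sets.\<close>

lemma cycles_iff:
  assumes "finite C"
  shows "\<Omega> \<in> cycles C dm k \<longleftrightarrow> Poly_Mapping.keys \<Omega> \<subseteq> cells C dm k \<and>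
    (\<forall>\<tau>. even (card {\<sigma> \<in> Poly_Mapping.keys \<Omega>. \<tau> \<in> facets C dm \<sigma>}))"
  by (auto simp: cycles_def chains_def poly_mapping_eq_iff fun_eq_iff lookup_boundary[OF assms]
      of_nat_bit_eq_0_iff)

text \<open>\<Gamma> is closed under subsets, so \<tau> is a facet of every simplex of the chain
  containing it, while a set outside \<Gamma> has no cofaces. For \<open>d = 0\<close> and empty
  \<tau> this is the vanishing of the augmentation.\<close>

lemma even_card_cofaces:
  assumes "simplicial_complex \<Gamma>" "\<Omega> \<in> cycles \<Gamma> sdim d" "sdim \<tau> = d - 1"
  shows "even (card {\<sigma> \<in> Poly_Mapping.keys \<Omega>. \<tau> \<subseteq> \<sigma>})"
proof -
  have fin: "finite \<Gamma>" using assms(1) by (simp add: simplicial_complex_def)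
  have "{\<sigma> \<in> Poly_Mapping.keys \<Omega>. \<tau> \<subseteq> \<sigma>} =
      {\<sigma> \<in> Poly_Mapping.keys \<Omega>. \<tau> \<in> facets \<Gamma> sdim \<sigma>}"
    using assms by (auto simp: cycles_iff[OF fin] facets_def cells_def simplicial_complex_def)
  then show ?thesis using assms(2) by (simp add: cycles_iff[OF fin])
qed

lemma card_cycle_simplex:
  "\<Omega> \<in> cycles \<Gamma> sdim d \<Longrightarrow> \<sigma> \<in> Poly_Mapping.keys \<Omega> \<Longrightarrow> int (card \<sigma>) = d + 1"
  by (auto simp: cycles_def chains_def cells_def sdim_def)

text \<open>A subset of a finite simplex with equally many elements is the whole simplex. Hence
  cardinality alone singles out the simplices of the chain within its support.\<close>

lemma chain_support_top_simplex:
  assumes "simplicial_complex \<Gamma>" "\<Omega> \<in> cycles \<Gamma> sdim d" "\<sigma> \<in> chain_support \<Omega>"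
  shows "int (card \<sigma>) \<le> d + 1" and "\<sigma> \<in> Poly_Mapping.keys \<Omega> \<longleftrightarrow> int (card \<sigma>) = d + 1"
proof -
  obtain \<rho> where \<rho>: "\<rho> \<in> Poly_Mapping.keys \<Omega>" "\<sigma> \<subseteq> \<rho>"
    using assms(3) by (auto simp: chain_support_def)
  then have "finite \<rho>" using assms(1,2)
    by (auto simp: cycles_def chains_def cells_def simplicial_complex_def)
  moreover have "int (card \<rho>) = d + 1" using card_cycle_simplex[OF assms(2) \<rho>(1)] .
  ultimately show "int (card \<sigma>) \<le> d + 1" "\<sigma> \<in> Poly_Mapping.keys \<Omega> \<longleftrightarrow> int (card \<sigma>) = d + 1"
    using \<rho> card_mono[of \<rho> \<sigma>] card_subset_eq[of \<rho> \<sigma>] card_cycle_simplex[OF assms(2), of \<sigma>]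
    by auto
qed

lemma no_cofaces:
  assumes "simplicial_complex \<Gamma>" "\<Omega> \<in> cycles \<Gamma> sdim d" "sdim \<tau> > d"
  shows "{\<sigma> \<in> Poly_Mapping.keys \<Omega>. \<tau> \<subseteq> \<sigma>} = {}"
proof -
  have "\<tau> \<in> chain_support \<Omega>" if "\<sigma> \<in> Poly_Mapping.keys \<Omega>" "\<tau> \<subseteq> \<sigma>" for \<sigma>
    using that by (auto simp: chain_support_def)
  then show ?thesis
    using chain_support_top_simplex(1)[OF assms(1,2), of \<tau>] assms(3) by (auto simp: sdim_def)
qed

lemma even_card_Sigma:
  assumes "finite S" "\<And>x. x \<in> S \<Longrightarrow> finite (T x)" "\<And>x. x \<in> S \<Longrightarrow> even (card (T x))"
  shows "even (card (Sigma S T))"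
  using assms by (auto intro: dvd_sum)

lemma even_card_symmetric_difference:
  assumes "finite S" "finite T" "even (card S)" "even (card T)"
  shows "even (card ((S - T) \<union> (T - S)))"
proof -
  have "card S = card (S - T) + card (S \<inter> T)" "card T = card (T - S) + card (S \<inter> T)"
    using assms card_Diff_subset_Int[of S T] card_Diff_subset_Int[of T S]
      card_mono[of S "S \<inter> T"] card_mono[of T "S \<inter> T"] by (auto simp: Int_commute)
  moreover have "card ((S - T) \<union> (T - S)) = card (S - T) + card (T - S)"
    using assms by (intro card_Un_disjoint) auto
  ultimately show ?thesis using assms(3,4) by presburger
qed

subsection \<open>Coloured complexes\<close>

lemma coloured_complexD:
  assumes "coloured_complex n \<Gamma> A"
  shows "simplicial_complex \<Gamma>" and "finite \<Gamma>"
    and "\<sigma> \<in> \<Gamma> \<Longrightarrow> finite \<sigma>"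
    and "\<sigma> \<in> \<Gamma> \<Longrightarrow> \<tau> \<subseteq> \<sigma> \<Longrightarrow> \<tau> \<in> \<Gamma>"
    and "\<sigma> \<in> \<Gamma> \<Longrightarrow> \<sigma> \<subseteq> (\<Union>i\<in>{1..n}. A i)"
    and "i \<in> {1..n} \<Longrightarrow> j \<in> {1..n} \<Longrightarrow> v \<in> A i \<Longrightarrow> v \<in> A j \<Longrightarrow> i = j"
proof -
  note d = assms[unfolded coloured_complex_def simplicial_complex_def]
  show "simplicial_complex \<Gamma>" "finite \<Gamma>" "\<sigma> \<in> \<Gamma> \<Longrightarrow> finite \<sigma>"
    "\<sigma> \<in> \<Gamma> \<Longrightarrow> \<tau> \<subseteq> \<sigma> \<Longrightarrow> \<tau> \<in> \<Gamma>"
    using d by (auto simp: simplicial_complex_def)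
  show "\<sigma> \<in> \<Gamma> \<Longrightarrow> \<sigma> \<subseteq> (\<Union>i\<in>{1..n}. A i)" using d by auto
  show "i \<in> {1..n} \<Longrightarrow> j \<in> {1..n} \<Longrightarrow> v \<in> A i \<Longrightarrow> v \<in> A j \<Longrightarrow> i = j"
    using d disjoint_family_onD[of A "{1..n}" i j] by blast
qed

lemma same_colour_eq:
  assumes "coloured_complex n \<Gamma> A" "\<sigma> \<in> \<Gamma>" "i \<in> {1..n}"
    and "u \<in> \<sigma> \<inter> A i" "v \<in> \<sigma> \<inter> A i"
  shows "u = v"
proof (rule ccontr)
  assume "u \<noteq> v"
  moreover have "{u, v} \<in> \<Gamma>"
    using assms by (intro coloured_complexD(4)[OF assms(1,2)]) auto
  ultimately show False
    using assms by (auto simp: coloured_complex_def)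
qed

text \<open>The colour classes cover the simplex and are disjoint, and adjacent vertices differ in
  colour, so vertices and colours correspond one to one.\<close>

lemma card_colours:
  assumes "coloured_complex n \<Gamma> A" "\<sigma> \<in> \<Gamma>"
  shows "card (colours n A \<sigma>) = card \<sigma>"
proof -
  have "\<sigma> = (\<Union>i\<in>{1..n}. \<sigma> \<inter> A i)"
    using coloured_complexD(5)[OF assms] by auto
  also have "card \<dots> = (\<Sum>i\<in>{1..n}. card (\<sigma> \<inter> A i))"
    using coloured_complexD(3)[OF assms] coloured_complexD(6)[OF assms(1)]
    by (intro card_UN_disjoint) auto
  also have "\<dots> = (\<Sum>i\<in>{1..n}. of_bool (i \<in> colours n A \<sigma>))"
  proof (rule sum.cong)
    fix i assume i: "i \<in> {1..n}"
    show "card (\<sigma> \<inter> A i) = of_bool (i \<in> colours n A \<sigma>)"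
    proof (cases "\<sigma> \<inter> A i = {}")
      case False
      then obtain v where "v \<in> \<sigma> \<inter> A i" by auto
      then have "\<sigma> \<inter> A i = {v}"
        using same_colour_eq[OF assms i] by blast
      then show ?thesis using i by (auto simp: colours_def)
    qed (simp add: colours_def)
  qed simp
  also have "\<dots> = card (colours n A \<sigma>)"
    by (simp add: colours_def Int_def)
  finally show ?thesis by simp
qed

lemma finite_colours [simp]: "finite (colours n A \<sigma>)"
  by (simp add: colours_def)

lemma colours_subset: "colours n A \<sigma> \<subseteq> {1..n}"
  by (auto simp: colours_def)

lemma colours_mono: "\<tau> \<subseteq> \<sigma> \<Longrightarrow> colours n A \<tau> \<subseteq> colours n A \<sigma>"
  by (auto simp: colours_def)

lemma coloured_chain_support:
  assumes col: "coloured_complex n \<Gamma> A" and \<Omega>: "\<Omega> \<in> cycles \<Gamma> sdim d" "\<Omega> \<noteq> 0"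
  shows "coloured_complex n (chain_support \<Omega>) (\<lambda>i. A i \<inter> \<Union>(chain_support \<Omega>))"
    and "chain_support \<Omega> \<subseteq> \<Gamma>"
proof -
  have keys: "Poly_Mapping.keys \<Omega> \<subseteq> \<Gamma>"
    using \<Omega>(1) by (auto simp: cycles_def chains_def cells_def)
  then show sub: "chain_support \<Omega> \<subseteq> \<Gamma>"
    using coloured_complexD(4)[OF col] by (auto simp: chain_support_def)
  \<comment> \<open>The empty simplex belongs to the support because the chain is non-zero.\<close>
  obtain \<sigma> where "\<sigma> \<in> Poly_Mapping.keys \<Omega>" using \<Omega>(2) by fastforce
  then have "{} \<in> chain_support \<Omega>" by (auto simp: chain_support_def)
  moreover have "\<tau> \<in> chain_support \<Omega>" if "\<sigma> \<in> chain_support \<Omega>" "\<tau> \<subseteq> \<sigma>" for \<sigma> \<tau>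
    using that by (auto simp: chain_support_def)
  moreover have "finite (chain_support \<Omega>)" "\<forall>\<sigma>\<in>chain_support \<Omega>. finite \<sigma>"
    using sub coloured_complexD(2,3)[OF col] finite_subset by auto
  ultimately have "simplicial_complex (chain_support \<Omega>)"
    by (auto simp: simplicial_complex_def)
  moreover have "(\<Union>i\<in>{1..n}. A i \<inter> \<Union>(chain_support \<Omega>)) = \<Union>(chain_support \<Omega>)"
    using sub coloured_complexD(5)[OF col] by blast
  moreover have "disjoint_family_on (\<lambda>i. A i \<inter> \<Union>(chain_support \<Omega>)) {1..n}"
    using coloured_complexD(6)[OF col] by (fastforce simp: disjoint_family_on_def)
  ultimately show "coloured_complex n (chain_support \<Omega>) (\<lambda>i. A i \<inter> \<Union>(chain_support \<Omega>))"
    using sub col by (auto simp: coloured_complex_def)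
qed

subsection \<open>Cubes as spanning pairs of simplices\<close>

lemma join_cellsD:
  assumes "e \<in> join_cells P Q"
  shows "e \<noteq> {}" and "Inl u \<in> e \<Longrightarrow> u \<in> P" and "Inr v \<in> e \<Longrightarrow> v \<in> Q"
    and "Inl u \<in> e \<Longrightarrow> Inl u' \<in> e \<Longrightarrow> u = u'" and "Inr v \<in> e \<Longrightarrow> Inr v' \<in> e \<Longrightarrow> v = v'"
proof -
  consider a where "a \<in> P" "e = {Inl a}" | b where "b \<in> Q" "e = {Inr b}"
    | a b where "a \<in> P" "b \<in> Q" "e = {Inl a, Inr b}"
    using assms unfolding join_cells_def by blast
  then show "e \<noteq> {}" "Inl u \<in> e \<Longrightarrow> u \<in> P" "Inr v \<in> e \<Longrightarrow> v \<in> Q"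
    "Inl u \<in> e \<Longrightarrow> Inl u' \<in> e \<Longrightarrow> u = u'" "Inr v \<in> e \<Longrightarrow> Inr v' \<in> e \<Longrightarrow> v = v'"
    by (cases; simp)+
qed

text \<open>Inclusion of products can be tested factor by factor once the smaller product is
  non-empty, which its spanning condition provides. The larger pair is arbitrary. Every vertex of a
  simplex has a colour, so the factors recover the simplices.\<close>

lemma coupled_cube_subset_iff:
  assumes "coloured_complex n \<Gamma>A A" "coloured_complex n \<Gamma>B B"
    and "\<aa>' \<in> \<Gamma>A" "\<bb>' \<in> \<Gamma>B" "{1..n} \<subseteq> colours n A \<aa>' \<union> colours n B \<bb>'"
  shows "coupled_cube n A B \<aa>' \<bb>' \<subseteq> coupled_cube n A B \<aa> \<bb> \<longleftrightarrow> \<aa>' \<subseteq> \<aa> \<and> \<bb>' \<subseteq> \<bb>"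
proof
  have ne: "coupled_cube n A B \<aa>' \<bb>' \<noteq> {}"
    using assms(5) by (auto simp: coupled_cube_def PiE_eq_empty_iff colours_def)
  assume "coupled_cube n A B \<aa>' \<bb>' \<subseteq> coupled_cube n A B \<aa> \<bb>"
  then have *: "\<forall>i\<in>{1..n}. Inl ` (\<aa>' \<inter> A i) \<union> Inr ` (\<bb>' \<inter> B i) \<subseteq>
      Inl ` (\<aa> \<inter> A i) \<union> Inr ` (\<bb> \<inter> B i)"
    using ne by (simp add: coupled_cube_def subset_PiE)
  then show "\<aa>' \<subseteq> \<aa> \<and> \<bb>' \<subseteq> \<bb>"
  proof (intro conjI subsetI)
    fix v assume "v \<in> \<aa>'"
    moreover then obtain i where "i \<in> {1..n}" "v \<in> A i"
      using coloured_complexD(5)[OF assms(1,3)] by auto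
    ultimately show "v \<in> \<aa>" using bspec[OF *, of i] by auto
  next
    fix v assume "v \<in> \<bb>'"
    moreover then obtain i where "i \<in> {1..n}" "v \<in> B i"
      using coloured_complexD(5)[OF assms(2,4)] by auto
    ultimately show "v \<in> \<bb>" using bspec[OF *, of i] by auto
  qed
next
  assume "\<aa>' \<subseteq> \<aa> \<and> \<bb>' \<subseteq> \<bb>"
  then show "coupled_cube n A B \<aa>' \<bb>' \<subseteq> coupled_cube n A B \<aa> \<bb>"
    unfolding coupled_cube_def by (intro PiE_mono) auto
qed

text \<open>Antisymmetry of inclusion. This turns the counting of cubes into the counting of
  pairs.\<close>

lemma inj_on_coupled_cube:
  assumes "coloured_complex n \<Gamma>A A" "coloured_complex n \<Gamma>B B"
  shows "inj_on (\<lambda>(\<aa>, \<bb>). coupled_cube n A B \<aa> \<bb>) (spanning_pairs n A B \<Gamma>A \<Gamma>B)"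
proof (rule inj_onI, clarify)
  fix \<aa> \<bb> \<aa>' \<bb>'
  assume sp: "(\<aa>, \<bb>) \<in> spanning_pairs n A B \<Gamma>A \<Gamma>B" "(\<aa>', \<bb>') \<in> spanning_pairs n A B \<Gamma>A \<Gamma>B"
    and eq: "coupled_cube n A B \<aa> \<bb> = coupled_cube n A B \<aa>' \<bb>'"
  then show "\<aa> = \<aa>' \<and> \<bb> = \<bb>'"
    using coupled_cube_subset_iff[OF assms, of \<aa> \<bb> \<aa>' \<bb>']
      coupled_cube_subset_iff[OF assms, of \<aa>' \<bb>' \<aa> \<bb>]
    by (auto simp: spanning_pairs_def)
qed

text \<open>A coordinate varies exactly when both simplices have a vertex of that colour.
  Inclusion-exclusion counts these colours, since the union of the two colour sets is
  everything.\<close>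

lemma cdim_coupled_cube:
  assumes "coloured_complex n \<Gamma>A A" "coloured_complex n \<Gamma>B B"
    and sp: "(\<aa>, \<bb>) \<in> spanning_pairs n A B \<Gamma>A \<Gamma>B"
  shows "cdim (coupled_cube n A B \<aa> \<bb>) = int (card \<aa>) + int (card \<bb>) - int n"
proof -
  let ?c = "\<lambda>i. Inl ` (\<aa> \<inter> A i) \<union> Inr ` (\<bb> \<inter> B i)"
  let ?Q = "coupled_cube n A B \<aa> \<bb>"
  have ab: "\<aa> \<in> \<Gamma>A" "\<bb> \<in> \<Gamma>B" and sp': "{1..n} \<subseteq> colours n A \<aa> \<union> colours n B \<bb>"
    using sp by (auto simp: spanning_pairs_def)
  have ne: "?Q \<noteq> {}"
    using sp' by (auto simp: coupled_cube_def PiE_eq_empty_iff colours_def)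
  then obtain z where z: "z \<in> ?Q" by auto
  have "{i. \<exists>x\<in>?Q. \<exists>y\<in>?Q. x i \<noteq> y i} = colours n A \<aa> \<inter> colours n B \<bb>"
  proof (intro equalityI subsetI)
    fix i assume "i \<in> {i. \<exists>x\<in>?Q. \<exists>y\<in>?Q. x i \<noteq> y i}"
    then obtain x y where xy: "x \<in> ?Q" "y \<in> ?Q" "x i \<noteq> y i" by auto
    \<comment> \<open>Outside \<open>{1..n}\<close> all points of the cube take the same default
      value.\<close>
    have i: "i \<in> {1..n}"
    proof (rule ccontr)
      assume "i \<notin> {1..n}"
      then show False
        using xy PiE_arb[of x "{1..n}" ?c i] PiE_arb[of y "{1..n}" ?c i]
        by (simp add: coupled_cube_def)
    qed
    then have "x i \<in> ?c i" "y i \<in> ?c i"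
      using xy by (auto simp: coupled_cube_def PiE_iff)
    then show "i \<in> colours n A \<aa> \<inter> colours n B \<bb>"
      using xy(3) i same_colour_eq[OF assms(1) ab(1) i] same_colour_eq[OF assms(2) ab(2) i]
      by (auto simp: colours_def)
  next
    fix i assume "i \<in> colours n A \<aa> \<inter> colours n B \<bb>"
    then obtain u v where uv: "i \<in> {1..n}" "u \<in> \<aa> \<inter> A i" "v \<in> \<bb> \<inter> B i"
      by (auto simp: colours_def)
    \<comment> \<open>An arbitrary point of the cube is moved to both ends of its edge in direction
      \<open>i\<close>.\<close>
    then have "z(i := Inl u) \<in> ?Q" "z(i := Inr v) \<in> ?Q"
      using z by (auto simp: coupled_cube_def PiE_iff extensional_def)
    then show "i \<in> {i. \<exists>x\<in>?Q. \<exists>y\<in>?Q. x i \<noteq> y i}"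
      by (intro CollectI bexI[of _ "z(i := Inl u)"] bexI[of _ "z(i := Inr v)"]) auto
  qed
  moreover have "colours n A \<aa> \<union> colours n B \<bb> = {1..n}"
    using sp' colours_subset[of n A \<aa>] colours_subset[of n B \<bb>] by blast
  moreover have "card (colours n A \<aa>) + card (colours n B \<bb>) =
      card (colours n A \<aa> \<union> colours n B \<bb>) + card (colours n A \<aa> \<inter> colours n B \<bb>)"
    by (rule card_Un_Int) auto
  ultimately show ?thesis
    using ne card_colours[OF assms(1) ab(1)] card_colours[OF assms(2) ab(2)]
    by (simp add: cdim_def)
qed

text \<open>Two vertices of a cube decide whether it lies in the link: one takes the A-end of each
  factor wherever there is one, the other the B-end. Their simplices are the largest that occur;
  those of any other vertex are faces of them.\<close>

lemma coupled_link_eq: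
  assumes "coloured_complex n \<Gamma>A A" "coloured_complex n \<Gamma>B B"
  shows "coupled_link n \<Gamma>A A \<Gamma>B B =
    (\<lambda>(\<aa>, \<bb>). coupled_cube n A B \<aa> \<bb>) ` spanning_pairs n A B \<Gamma>A \<Gamma>B"
proof (intro equalityI subsetI)
  fix Q assume "Q \<in> coupled_link n \<Gamma>A A \<Gamma>B B"
  then obtain c where Q: "Q = PiE {1..n} c"
    and c: "\<And>i. i \<in> {1..n} \<Longrightarrow> c i \<in> join_cells (A i) (B i)"
    and sub: "Q \<subseteq> coupled_vertices n \<Gamma>A A \<Gamma>B B"
    by (auto simp: coupled_link_def product_cubes_def)
  define \<aa> where "\<aa> = {v. \<exists>i\<in>{1..n}. Inl v \<in> c i}"
  define \<bb> where "\<bb> = {v. \<exists>i\<in>{1..n}. Inr v \<in> c i}"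
  have cA: "v \<in> A i" if "i \<in> {1..n}" "Inl v \<in> c i" for i v
    using join_cellsD(2)[OF c[OF that(1)] that(2)] .
  have cB: "v \<in> B i" if "i \<in> {1..n}" "Inr v \<in> c i" for i v
    using join_cellsD(3)[OF c[OF that(1)] that(2)] .
  have c_ne: "c i \<noteq> {}" if "i \<in> {1..n}" for i
    using join_cellsD(1)[OF c[OF that]] .
  have c_eq: "c i = Inl ` (\<aa> \<inter> A i) \<union> Inr ` (\<bb> \<inter> B i)" if i: "i \<in> {1..n}" for i
  proof (rule set_eqI)
    fix x show "x \<in> c i \<longleftrightarrow> x \<in> Inl ` (\<aa> \<inter> A i) \<union> Inr ` (\<bb> \<inter> B i)"
    proof (cases x)
      case (Inl v)
      \<comment> \<open>A vertex occurring in factor \<open>j\<close> has colour \<open>j\<close>,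
        so disjointness of the classes leaves only \<open>j = i\<close>.\<close>
      have "Inl v \<in> c i" if "v \<in> A i" "j \<in> {1..n}" "Inl v \<in> c j" for j
        using coloured_complexD(6)[OF assms(1) i that(2,1) cA[OF that(2,3)]] that(3) by simp
      then have "Inl v \<in> c i \<longleftrightarrow> v \<in> \<aa> \<inter> A i"
        using i cA[OF i] unfolding \<aa>_def by blast
      then show ?thesis using Inl by auto
    next
      case (Inr v)
      have "Inr v \<in> c i" if "v \<in> B i" "j \<in> {1..n}" "Inr v \<in> c j" for j
        using coloured_complexD(6)[OF assms(2) i that(2,1) cB[OF that(2,3)]] that(3) by simp
      then have "Inr v \<in> c i \<longleftrightarrow> v \<in> \<bb> \<inter> B i"
        using i cB[OF i] unfolding \<bb>_def by blast
      then show ?thesis using Inr by auto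
    qed
  qed
  \<comment> \<open>The first choice prefers the A-end of a factor, the second the B-end; each
    factor has at most one end of either kind.\<close>
  have "\<exists>w. w \<in> c i \<and> (\<forall>v. Inl v \<in> c i \<longrightarrow> w = Inl v)"
    "\<exists>w. w \<in> c i \<and> (\<forall>v. Inr v \<in> c i \<longrightarrow> w = Inr v)" if "i \<in> {1..n}" for i
    using c_ne[OF that] join_cellsD(4,5)[OF c[OF that]] by blast+
  then obtain x y where x: "\<And>i. i \<in> {1..n} \<Longrightarrow> x i \<in> c i \<and> (\<forall>v. Inl v \<in> c i \<longrightarrow> x i = Inl v)"
    and y: "\<And>i. i \<in> {1..n} \<Longrightarrow> y i \<in> c i \<and> (\<forall>v. Inr v \<in> c i \<longrightarrow> y i = Inr v)"
    by metis
  have "restrict x {1..n} \<in> Q" "restrict y {1..n} \<in> Q"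
    using x y unfolding Q by simp_all
  moreover have "A_part n (restrict x {1..n}) = \<aa>"
  proof -
    have "(\<exists>i\<in>{1..n}. x i = Inl v) \<longleftrightarrow> (\<exists>i\<in>{1..n}. Inl v \<in> c i)" for v
      using x by metis
    then show ?thesis by (simp add: A_part_def \<aa>_def)
  qed
  moreover have "B_part n (restrict y {1..n}) = \<bb>"
  proof -
    have "(\<exists>i\<in>{1..n}. y i = Inr v) \<longleftrightarrow> (\<exists>i\<in>{1..n}. Inr v \<in> c i)" for v
      using y by metis
    then show ?thesis by (simp add: B_part_def \<bb>_def)
  qed
  ultimately have "\<aa> \<in> \<Gamma>A" "\<bb> \<in> \<Gamma>B"
    using sub by (auto simp: coupled_vertices_def)
  moreover have "{1..n} \<subseteq> colours n A \<aa> \<union> colours n B \<bb>"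
    using c_ne c_eq by (fastforce simp: colours_def)
  moreover have "Q = coupled_cube n A B \<aa> \<bb>"
    unfolding Q coupled_cube_def using c_eq by (intro PiE_cong)
  ultimately show "Q \<in> (\<lambda>(\<aa>, \<bb>). coupled_cube n A B \<aa> \<bb>) ` spanning_pairs n A B \<Gamma>A \<Gamma>B"
    by (auto simp: spanning_pairs_def)
next
  fix Q assume "Q \<in> (\<lambda>(\<aa>, \<bb>). coupled_cube n A B \<aa> \<bb>) ` spanning_pairs n A B \<Gamma>A \<Gamma>B"
  then obtain \<aa> \<bb> where Q: "Q = coupled_cube n A B \<aa> \<bb>" and ab: "\<aa> \<in> \<Gamma>A" "\<bb> \<in> \<Gamma>B"
    and sp: "{1..n} \<subseteq> colours n A \<aa> \<union> colours n B \<bb>"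
    by (auto simp: spanning_pairs_def)
  have "Inl ` (\<aa> \<inter> A i) \<union> Inr ` (\<bb> \<inter> B i) \<in> join_cells (A i) (B i)" if i: "i \<in> {1..n}" for i
  proof -
    have "\<aa> \<inter> A i = {} \<or> (\<exists>v. \<aa> \<inter> A i = {v})" "\<bb> \<inter> B i = {} \<or> (\<exists>v. \<bb> \<inter> B i = {v})"
      using same_colour_eq[OF assms(1) ab(1) i] same_colour_eq[OF assms(2) ab(2) i] by blast+
    moreover have "\<aa> \<inter> A i \<noteq> {} \<or> \<bb> \<inter> B i \<noteq> {}"
      using sp i by (auto simp: colours_def)
    ultimately consider v where "v \<in> A i" "\<aa> \<inter> A i = {v}" "\<bb> \<inter> B i = {}"
      | w where "w \<in> B i" "\<aa> \<inter> A i = {}" "\<bb> \<inter> B i = {w}"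
      | v w where "v \<in> A i" "w \<in> B i" "\<aa> \<inter> A i = {v}" "\<bb> \<inter> B i = {w}"
      by blast
    then show ?thesis
      by cases (auto simp: join_cells_def)
  qed
  then have "Q \<in> product_cubes n A B"
    unfolding Q coupled_cube_def product_cubes_def by blast
  moreover have "x \<in> coupled_vertices n \<Gamma>A A \<Gamma>B B" if x: "x \<in> Q" for x
  proof -
    have xi: "x i \<in> Inl ` (\<aa> \<inter> A i) \<union> Inr ` (\<bb> \<inter> B i)" if "i \<in> {1..n}" for i
      using x that by (auto simp: Q coupled_cube_def PiE_iff)
    have "A_part n x \<subseteq> \<aa>" "B_part n x \<subseteq> \<bb>"
      using xi by (fastforce simp: A_part_def B_part_def)+
    then have "A_part n x \<in> \<Gamma>A" "B_part n x \<in> \<Gamma>B"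
      using coloured_complexD(4) assms ab by metis+
    moreover have "x \<in> (\<Pi>\<^sub>E i\<in>{1..n}. A i <+> B i)"
      using x unfolding Q coupled_cube_def by (rule subsetD[OF PiE_mono, rotated]) auto
    ultimately show ?thesis by (simp add: coupled_vertices_def)
  qed
  ultimately show "Q \<in> coupled_link n \<Gamma>A A \<Gamma>B B"
    by (auto simp: coupled_link_def)
qed

section \<open>The cubes occurring in the coupled chain\<close>

lemma finite_spanning_pairs:
  "finite S \<Longrightarrow> finite T \<Longrightarrow> finite (spanning_pairs n A B S T)"
  unfolding spanning_pairs_def by (rule finite_subset[of _ "S \<times> T"]) auto

text \<open>In the supports the two simplices have at most \<open>dA + 1\<close> and
  \<open>dB + 1\<close> vertices, so a cube reaches dimension \<open>dA + dB + 2 - n\<close> only if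
  both bounds are attained, that is, if both simplices belong to the chains.\<close>

lemma keys_coupled_chain:
  assumes col: "coloured_complex n \<Gamma>A A" "coloured_complex n \<Gamma>B B"
    and \<Omega>A: "\<Omega>A \<in> cycles \<Gamma>A sdim dA" "\<Omega>A \<noteq> 0"
    and \<Omega>B: "\<Omega>B \<in> cycles \<Gamma>B sdim dB" "\<Omega>B \<noteq> 0"
  shows "Poly_Mapping.keys (coupled_chain n A B dA dB \<Omega>A \<Omega>B) =
    (\<lambda>(\<aa>, \<bb>). coupled_cube n A B \<aa> \<bb>) `
      spanning_pairs n A B (Poly_Mapping.keys \<Omega>A) (Poly_Mapping.keys \<Omega>B)"
proof -
  define \<chi>A where "\<chi>A = chain_support \<Omega>A"
  define \<chi>B where "\<chi>B = chain_support \<Omega>B"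
  define A' where "A' = (\<lambda>i. A i \<inter> \<Union>\<chi>A)"
  define B' where "B' = (\<lambda>i. B i \<inter> \<Union>\<chi>B)"
  define L where "L = cells (coupled_link n \<chi>A A' \<chi>B B') cdim (dA + dB + 2 - int n)"
  have col': "coloured_complex n \<chi>A A'" "coloured_complex n \<chi>B B'"
    using coloured_chain_support col \<Omega>A \<Omega>B unfolding \<chi>A_def \<chi>B_def A'_def B'_def by blast+
  note fin = coloured_complexD(2)[OF col'(1)] coloured_complexD(2)[OF col'(2)]
  \<comment> \<open>Restricting the colour classes to the vertices of the supports changes no
    intersection with a simplex of the supports.\<close>
  have restrict: "coupled_cube n A' B' \<aa> \<bb> = coupled_cube n A B \<aa> \<bb>"
    "colours n A' \<aa> = colours n A \<aa>" "colours n B' \<bb> = colours n B \<bb>"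
    if "\<aa> \<in> \<chi>A" "\<bb> \<in> \<chi>B" for \<aa> \<bb>
  proof -
    have "\<aa> \<inter> A' i = \<aa> \<inter> A i" "\<bb> \<inter> B' i = \<bb> \<inter> B i" for i
      using that by (auto simp: A'_def B'_def)
    then show "coupled_cube n A' B' \<aa> \<bb> = coupled_cube n A B \<aa> \<bb>"
      "colours n A' \<aa> = colours n A \<aa>" "colours n B' \<bb> = colours n B \<bb>"
      by (simp_all add: coupled_cube_def colours_def)
  qed
  have mem: "(\<aa>, \<bb>) \<in> spanning_pairs n A B (Poly_Mapping.keys \<Omega>A) (Poly_Mapping.keys \<Omega>B) \<longleftrightarrow>
      (\<aa>, \<bb>) \<in> spanning_pairs n A' B' \<chi>A \<chi>B \<and>
      cdim (coupled_cube n A' B' \<aa> \<bb>) = dA + dB + 2 - int n" for \<aa> \<bb>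
  proof (cases "\<aa> \<in> \<chi>A \<and> \<bb> \<in> \<chi>B")
    case True
    then show ?thesis
      using chain_support_top_simplex[OF coloured_complexD(1)[OF col(1)] \<Omega>A(1), of \<aa>]
        chain_support_top_simplex[OF coloured_complexD(1)[OF col(2)] \<Omega>B(1), of \<bb>] restrict[of \<aa> \<bb>]
        cdim_coupled_cube[OF col', of \<aa> \<bb>]
      unfolding \<chi>A_def[symmetric] \<chi>B_def[symmetric]
      by (auto simp: spanning_pairs_def)
  next
    case False
    moreover have "Poly_Mapping.keys \<Omega>A \<subseteq> \<chi>A" "Poly_Mapping.keys \<Omega>B \<subseteq> \<chi>B"
      by (auto simp: \<chi>A_def \<chi>B_def chain_support_def)
    ultimately show ?thesis by (auto simp: spanning_pairs_def)
  qed
  have "L = (\<lambda>(\<aa>, \<bb>). coupled_cube n A' B' \<aa> \<bb>) `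
      spanning_pairs n A B (Poly_Mapping.keys \<Omega>A) (Poly_Mapping.keys \<Omega>B)"
    unfolding L_def cells_def coupled_link_eq[OF col'] using mem by fastforce
  also have "\<dots> = (\<lambda>(\<aa>, \<bb>). coupled_cube n A B \<aa> \<bb>) `
      spanning_pairs n A B (Poly_Mapping.keys \<Omega>A) (Poly_Mapping.keys \<Omega>B)"
  proof (rule image_cong[OF refl], clarify)
    fix \<aa> \<bb> assume "(\<aa>, \<bb>) \<in> spanning_pairs n A B (Poly_Mapping.keys \<Omega>A) (Poly_Mapping.keys \<Omega>B)"
    then have "\<aa> \<in> \<chi>A" "\<bb> \<in> \<chi>B"
      by (auto simp: spanning_pairs_def \<chi>A_def \<chi>B_def chain_support_def)
    then show "coupled_cube n A' B' \<aa> \<bb> = coupled_cube n A B \<aa> \<bb>"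
      by (rule restrict(1))
  qed
  finally have L: "L = \<dots>" .
  \<comment> \<open>A sum over an infinite set would be zero by convention, so finiteness is needed
    to read off the keys.\<close>
  have "finite L"
    using fin by (simp add: L_def cells_def coupled_link_eq[OF col'] finite_spanning_pairs)
  then show ?thesis
    unfolding L[symmetric]
    by (simp add: coupled_chain_def Let_def keys_sum_of_cells L_def A'_def B'_def \<chi>A_def \<chi>B_def)
qed

subsection \<open>Parity of the number of spanning pairs\<close>

text \<open>A top simplex whose colours include \<open>U\<close> has exactly one face with colour
  set \<open>U\<close>, and this face has codimension one. Grouping by that face yields groups that
  are even by the cycle condition.\<close>

lemma even_card_colours_superset:
  assumes col: "coloured_complex n \<Gamma> A" and \<Omega>: "\<Omega> \<in> cycles \<Gamma> sdim d"
    and U: "U \<subseteq> {1..n}" "int (card U) = d"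
  shows "even (card {\<sigma> \<in> Poly_Mapping.keys \<Omega>. U \<subseteq> colours n A \<sigma>})"
proof -
  let ?R = "{\<tau> \<in> \<Gamma>. colours n A \<tau> = U}"
  let ?S = "\<lambda>\<tau>. {\<sigma> \<in> Poly_Mapping.keys \<Omega>. \<tau> \<subseteq> \<sigma>}"
  have keys: "Poly_Mapping.keys \<Omega> \<subseteq> \<Gamma>"
    using \<Omega> by (auto simp: cycles_def chains_def cells_def)
  \<comment> \<open>The face is cut out of \<sigma> by the classes of \<open>U\<close>, hence
    determined by \<sigma>; so the groups are disjoint.\<close>
  have face: "\<tau> = \<sigma> \<inter> (\<Union>i\<in>U. A i)" if "\<tau> \<in> ?R" "\<sigma> \<in> ?S \<tau>" for \<tau> \<sigma>
  proof (intro equalityI subsetI)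
    fix v assume v: "v \<in> \<tau>"
    have "\<tau> \<subseteq> (\<Union>i\<in>{1..n}. A i)"
      using that coloured_complexD(5)[OF col, of \<tau>] by simp
    then obtain i where i: "i \<in> {1..n}" "v \<in> A i" using v by auto
    then have "i \<in> colours n A \<tau>" using v by (auto simp: colours_def)
    then show "v \<in> \<sigma> \<inter> (\<Union>i\<in>U. A i)" using that v i by auto
  next
    fix v assume "v \<in> \<sigma> \<inter> (\<Union>i\<in>U. A i)"
    then obtain i where i: "i \<in> U" "v \<in> \<sigma> \<inter> A i" by auto
    have "i \<in> colours n A \<tau>" using that i by simp
    then obtain w where w: "w \<in> \<tau> \<inter> A i" by (auto simp: colours_def)
    have "\<sigma> \<in> \<Gamma>" "i \<in> {1..n}" "w \<in> \<sigma> \<inter> A i" using that keys i w U by blast+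
    then have "v = w" using same_colour_eq[OF col _ _ i(2)] by blast
    then show "v \<in> \<tau>" using w by simp
  qed
  have "{\<sigma> \<in> Poly_Mapping.keys \<Omega>. U \<subseteq> colours n A \<sigma>} = (\<Union>\<tau>\<in>?R. ?S \<tau>)"
  proof (intro equalityI subsetI)
    fix \<sigma> assume \<sigma>: "\<sigma> \<in> {\<sigma> \<in> Poly_Mapping.keys \<Omega>. U \<subseteq> colours n A \<sigma>}"
    let ?\<tau> = "\<sigma> \<inter> (\<Union>i\<in>U. A i)"
    have "?\<tau> \<in> \<Gamma>" using coloured_complexD(4)[OF col, of \<sigma> ?\<tau>] \<sigma> keys by blast
    moreover have "colours n A ?\<tau> = U"
    proof (intro equalityI subsetI)
      fix i assume "i \<in> colours n A ?\<tau>"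
      then obtain v j where "i \<in> {1..n}" "j \<in> U" "v \<in> A i" "v \<in> A j"
        by (auto simp: colours_def)
      then show "i \<in> U" using coloured_complexD(6)[OF col, of i j v] U by auto
    next
      fix i assume "i \<in> U"
      then obtain v where "v \<in> \<sigma>" "v \<in> A i" "i \<in> {1..n}" using \<sigma> by (auto simp: colours_def)
      then show "i \<in> colours n A ?\<tau>" using \<open>i \<in> U\<close> by (auto simp: colours_def)
    qed
    ultimately show "\<sigma> \<in> (\<Union>\<tau>\<in>?R. ?S \<tau>)" using \<sigma> by blast
  next
    fix \<sigma> assume "\<sigma> \<in> (\<Union>\<tau>\<in>?R. ?S \<tau>)"
    then show "\<sigma> \<in> {\<sigma> \<in> Poly_Mapping.keys \<Omega>. U \<subseteq> colours n A \<sigma>}"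
      using colours_mono by blast
  qed
  moreover have "card (\<Union>\<tau>\<in>?R. ?S \<tau>) = (\<Sum>\<tau>\<in>?R. card (?S \<tau>))"
  proof (rule card_UN_disjoint)
    show "\<forall>\<tau>\<in>?R. \<forall>\<tau>'\<in>?R. \<tau> \<noteq> \<tau>' \<longrightarrow> ?S \<tau> \<inter> ?S \<tau>' = {}"
    proof (intro ballI impI, rule ccontr)
      fix \<tau> \<tau>' assume R: "\<tau> \<in> ?R" "\<tau>' \<in> ?R" and "\<tau> \<noteq> \<tau>'" "?S \<tau> \<inter> ?S \<tau>' \<noteq> {}"
      then obtain \<sigma> where "\<sigma> \<in> ?S \<tau>" "\<sigma> \<in> ?S \<tau>'" by blast
      then show False using face[OF R(1)] face[OF R(2)] \<open>\<tau> \<noteq> \<tau>'\<close> by metis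
    qed
  qed (use coloured_complexD(2)[OF col] in simp_all)
  moreover have "even (card (?S \<tau>))" if "\<tau> \<in> ?R" for \<tau>
    using that card_colours[OF col, of \<tau>] U
    by (intro even_card_cofaces[OF coloured_complexD(1)[OF col] \<Omega>]) (auto simp: sdim_def)
  ultimately show ?thesis using dvd_sum[of ?R 2 "\<lambda>\<tau>. card (?S \<tau>)"] by presburger
qed

text \<open>Fix \<bb> without colour 1. Its \<open>dB + 1\<close> colours lie in
  \<open>{2..n}\<close>, so \<aa> has to cover the remaining \<open>n - 1 - (dB + 1) = dA\<close>
  colours, and the number of such \<aa> is even. The pairs list \<bb> first to form a dependent sum
  over \<bb>.\<close>

lemma even_card_almost_spanning:
  assumes col: "coloured_complex n \<Gamma>A A" "coloured_complex n \<Gamma>B B"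
    and \<Omega>: "\<Omega>A \<in> cycles \<Gamma>A sdim dA" "\<Omega>B \<in> cycles \<Gamma>B sdim dB"
    and dim: "dA + dB + 2 = int n" and "n \<ge> 1"
  shows "even (card {(\<bb>, \<aa>) \<in> Poly_Mapping.keys \<Omega>B \<times> Poly_Mapping.keys \<Omega>A.
    1 \<notin> colours n B \<bb> \<and> {2..n} \<subseteq> colours n A \<aa> \<union> colours n B \<bb>})" (is "even (card ?P)")
proof -
  let ?S = "{\<bb> \<in> Poly_Mapping.keys \<Omega>B. 1 \<notin> colours n B \<bb>}"
  let ?T = "\<lambda>\<bb>. {\<aa> \<in> Poly_Mapping.keys \<Omega>A. {2..n} - colours n B \<bb> \<subseteq> colours n A \<aa>}"
  have "even (card (?T \<bb>))" if b: "\<bb> \<in> ?S" for \<bb>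
  proof (rule even_card_colours_superset[OF col(1) \<Omega>(1)])
    have "\<bb> \<in> \<Gamma>B" using b \<Omega>(2) by (auto simp: cycles_def chains_def cells_def)
    then have "int (card (colours n B \<bb>)) = dB + 1"
      using card_colours[OF col(2)] card_cycle_simplex[OF \<Omega>(2)] b by simp
    moreover have sub: "colours n B \<bb> \<subseteq> {2..n}"
    proof
      fix i assume "i \<in> colours n B \<bb>"
      then show "i \<in> {2..n}" using b colours_subset[of n B \<bb>] by (cases "i = 1") auto
    qed
    \<comment> \<open>This makes the truncated subtraction in the cardinality of the difference
      exact.\<close>
    moreover have "card (colours n B \<bb>) \<le> card {2..n}"
      using sub by (intro card_mono) auto
    ultimately show "int (card ({2..n} - colours n B \<bb>)) = dA"
      using dim \<open>n \<ge> 1\<close> by (simp add: card_Diff_subset)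
  qed auto
  then have "even (card (Sigma ?S ?T))" by (intro even_card_Sigma) auto
  moreover have "?P = Sigma ?S ?T" by auto
  ultimately show ?thesis by simp
qed

text \<open>
  Each of the two families of pairs covering the colours \<open>2, \<dots>, n\<close> in which a prescribed side
  misses the colour \<open>1\<close> is even, and they differ exactly in the spanning pairs.
\<close>

lemma even_card_spanning_pairs:
  assumes col: "coloured_complex n \<Gamma>A A" "coloured_complex n \<Gamma>B B"
    and \<Omega>: "\<Omega>A \<in> cycles \<Gamma>A sdim dA" "\<Omega>B \<in> cycles \<Gamma>B sdim dB"
    and dim: "dA + dB + 2 = int n" and "n \<ge> 1"
  shows "even (card (spanning_pairs n A B (Poly_Mapping.keys \<Omega>A) (Poly_Mapping.keys \<Omega>B)))"
proof -
  let ?F = "{(\<aa>, \<bb>) \<in> Poly_Mapping.keys \<Omega>A \<times> Poly_Mapping.keys \<Omega>B.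
    1 \<notin> colours n A \<aa> \<and> {2..n} \<subseteq> colours n B \<bb> \<union> colours n A \<aa>}"
  let ?G' = "{(\<bb>, \<aa>) \<in> Poly_Mapping.keys \<Omega>B \<times> Poly_Mapping.keys \<Omega>A.
    1 \<notin> colours n B \<bb> \<and> {2..n} \<subseteq> colours n A \<aa> \<union> colours n B \<bb>}"
  let ?G = "prod.swap ` ?G'"
  have "even (card ?F)"
    using even_card_almost_spanning[OF col(2,1) \<Omega>(2,1)] dim \<open>n \<ge> 1\<close> by simp
  moreover have "even (card ?G)"
    using even_card_almost_spanning[OF col \<Omega> dim \<open>n \<ge> 1\<close>] by (simp add: card_image)
  moreover have "finite ?F"
    by (rule finite_subset[of _ "Poly_Mapping.keys \<Omega>A \<times> Poly_Mapping.keys \<Omega>B"]) auto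
  moreover have "finite ?G'"
    by (rule finite_subset[of _ "Poly_Mapping.keys \<Omega>B \<times> Poly_Mapping.keys \<Omega>A"]) auto
  ultimately have "even (card ((?F - ?G) \<union> (?G - ?F)))"
    by (intro even_card_symmetric_difference) auto
  \<comment> \<open>Pairs with colour 1 on neither side lie in both families and cancel; pairs with
    it on both sides lie in neither. A covering pair with it on exactly one side lies in exactly one
    family.\<close>
  moreover have "(?F - ?G) \<union> (?G - ?F) =
    spanning_pairs n A B (Poly_Mapping.keys \<Omega>A) (Poly_Mapping.keys \<Omega>B)"
  proof -
    have split: "{1..n} = insert 1 {2..n}" using \<open>n \<ge> 1\<close> by auto
    \<comment> \<open>The cardinalities of the colour sets add up to \<open>n\<close>, so a spanning
      pair partitions the colours.\<close>
    have disj: "\<not> (1 \<in> colours n A \<aa> \<and> 1 \<in> colours n B \<bb>)"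
      if ab: "\<aa> \<in> Poly_Mapping.keys \<Omega>A" "\<bb> \<in> Poly_Mapping.keys \<Omega>B"
        and sp: "{1..n} \<subseteq> colours n A \<aa> \<union> colours n B \<bb>" for \<aa> \<bb>
    proof -
      have "\<aa> \<in> \<Gamma>A" "\<bb> \<in> \<Gamma>B" using ab \<Omega> by (auto simp: cycles_def chains_def cells_def)
      then have "int (card (colours n A \<aa>) + card (colours n B \<bb>)) = int n"
        using card_colours[OF col(1)] card_colours[OF col(2)] card_cycle_simplex[OF \<Omega>(1) ab(1)]
          card_cycle_simplex[OF \<Omega>(2) ab(2)] dim by simp
      moreover have "colours n A \<aa> \<union> colours n B \<bb> = {1..n}"
        using sp colours_subset[of n A \<aa>] colours_subset[of n B \<bb>] by blast
      ultimately have "card (colours n A \<aa> \<inter> colours n B \<bb>) = 0"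
        using card_Un_Int[of "colours n A \<aa>" "colours n B \<bb>"] by simp
      then show ?thesis by auto
    qed
    show ?thesis
    proof (rule set_eqI)
      fix p :: "'a set \<times> 'b set"
      obtain \<aa> \<bb> where p: "p = (\<aa>, \<bb>)" by force
      have G: "(\<aa>, \<bb>) \<in> ?G \<longleftrightarrow> (\<bb>, \<aa>) \<in> ?G'" by force
      show "p \<in> (?F - ?G) \<union> (?G - ?F) \<longleftrightarrow>
          p \<in> spanning_pairs n A B (Poly_Mapping.keys \<Omega>A) (Poly_Mapping.keys \<Omega>B)"
        unfolding p Un_iff Diff_iff G using disj[of \<aa> \<bb>]
        unfolding spanning_pairs_def split by auto
    qed
  qed
  ultimately show ?thesis by simp
qed

text \<open>The codimensions of \<aa> and \<bb> relative to \<open>dA\<close> and \<open>dB\<close>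
  add up to 1. Either one of them equals 1, making that factor even, or one is negative, making that
  factor empty.\<close>

lemma even_card_cofaces_pairs:
  assumes "simplicial_complex \<Gamma>A" "simplicial_complex \<Gamma>B"
    and \<Omega>: "\<Omega>A \<in> cycles \<Gamma>A sdim dA" "\<Omega>B \<in> cycles \<Gamma>B sdim dB"
    and dim: "sdim \<aa> + sdim \<bb> = dA + dB - 1"
  shows "even (card ({\<sigma> \<in> Poly_Mapping.keys \<Omega>A. \<aa> \<subseteq> \<sigma>} \<times> {\<sigma> \<in> Poly_Mapping.keys \<Omega>B. \<bb> \<subseteq> \<sigma>}))"
proof -
  consider "sdim \<aa> = dA - 1" | "sdim \<bb> = dB - 1" | "sdim \<aa> > dA" | "sdim \<bb> > dB"
    using dim by linarith
  then show ?thesis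
  proof cases
    case 1
    then show ?thesis using even_card_cofaces[OF assms(1) \<Omega>(1)] by (simp add: card_cartesian_product)
  next
    case 2
    then show ?thesis using even_card_cofaces[OF assms(2) \<Omega>(2)] by (simp add: card_cartesian_product)
  qed (simp_all add: no_cofaces[OF assms(1) \<Omega>(1)] no_cofaces[OF assms(2) \<Omega>(2)])
qed

section \<open>Non-vanishing and the cycle condition for the coupled chain\<close>

theorem propositionC:
  fixes n :: nat and \<Gamma>A :: "'a set set" and \<Gamma>B :: "'b set set"
    and A :: "nat \<Rightarrow> 'a set" and B :: "nat \<Rightarrow> 'b set"
    and dA dB :: int and \<Omega>A :: "'a chain" and \<Omega>B :: "'b chain"
  assumes "coloured_complex n \<Gamma>A A" and "coloured_complex n \<Gamma>B B"
    and "\<Omega>A \<in> cycles \<Gamma>A sdim dA" and "\<Omega>A \<noteq> 0"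
    and "\<Omega>B \<in> cycles \<Gamma>B sdim dB" and "\<Omega>B \<noteq> 0"
    and "smartly_paired n A B dA dB \<Omega>A \<Omega>B"
  shows "coupled_chain n A B dA dB \<Omega>A \<Omega>B \<noteq> 0 \<and>
    coupled_chain n A B dA dB \<Omega>A \<Omega>B
      \<in> cycles (coupled_link n \<Gamma>A A \<Gamma>B B) cdim (dA + dB + 2 - int n) \<and>
    (n \<ge> 1 \<longrightarrow> coupled_chain n A B dA dB \<Omega>A \<Omega>B
      \<in> cycles (insert {} (coupled_link n \<Gamma>A A \<Gamma>B B)) cdim (dA + dB + 2 - int n))"
proof -
  note col = assms(1,2) and \<Omega> = assms(3,5)
  let ?KA = "Poly_Mapping.keys \<Omega>A" and ?KB = "Poly_Mapping.keys \<Omega>B"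
  let ?cube = "\<lambda>(\<aa>, \<bb>). coupled_cube n A B \<aa> \<bb>"
  let ?X = "coupled_chain n A B dA dB \<Omega>A \<Omega>B" and ?L = "coupled_link n \<Gamma>A A \<Gamma>B B"
  let ?k = "dA + dB + 2 - int n"
  note keys = keys_coupled_chain[OF col assms(3-6)]
  note inj = inj_on_coupled_cube[OF col]
  have sub: "?KA \<subseteq> \<Gamma>A" "?KB \<subseteq> \<Gamma>B"
    using \<Omega> by (auto simp: cycles_def chains_def cells_def)
  then have sp_sub: "spanning_pairs n A B ?KA ?KB \<subseteq> spanning_pairs n A B \<Gamma>A \<Gamma>B"
    by (auto simp: spanning_pairs_def)
  have finL: "finite ?L"
    using coloured_complexD(2)[OF col(1)] coloured_complexD(2)[OF col(2)]
    by (simp add: coupled_link_eq[OF col] finite_spanning_pairs)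
  have cells: "Poly_Mapping.keys ?X \<subseteq> cells ?L cdim ?k"
  proof
    fix Q assume "Q \<in> Poly_Mapping.keys ?X"
    then obtain \<aa> \<bb> where Q: "Q = coupled_cube n A B \<aa> \<bb>"
      and ab: "(\<aa>, \<bb>) \<in> spanning_pairs n A B ?KA ?KB" by (auto simp: keys)
    then have "\<aa> \<in> ?KA" "\<bb> \<in> ?KB" by (auto simp: spanning_pairs_def)
    then have "cdim Q = ?k"
      using cdim_coupled_cube[OF col subsetD[OF sp_sub ab]] card_cycle_simplex[OF \<Omega>(1)]
        card_cycle_simplex[OF \<Omega>(2)] by (simp add: Q)
    then show "Q \<in> cells ?L cdim ?k"
      using Q ab sp_sub by (auto simp: cells_def coupled_link_eq[OF col])
  qed
  have nonzero: "?X \<noteq> 0"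
  proof -
    obtain \<aa> where a: "\<aa> \<in> ?KA" using assms(4) by fastforce
    then have "\<aa> \<in> cells (chain_support \<Omega>A) sdim dA"
      using \<Omega>(1) by (auto simp: cycles_def chains_def cells_def chain_support_def)
    then obtain \<bb>' where "\<bb>' \<in> chain_support \<Omega>B" and compl: "complementary n A B \<aa> \<bb>'"
      using assms(7) by (auto simp: smartly_paired_def)
    \<comment> \<open>The complementary simplex may be a proper face of a top simplex. Passing to
      the top simplex only adds colours, so the pair stays spanning.\<close>
    then obtain \<bb> where b: "\<bb> \<in> ?KB" "\<bb>' \<subseteq> \<bb>" by (auto simp: chain_support_def)
    have "{1..n} \<subseteq> colours n A \<aa> \<union> colours n B \<bb>"
      using compl b(2) by (fastforce simp: complementary_def colours_def)
    then have "Poly_Mapping.keys ?X \<noteq> {}"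
      using a b(1) by (auto simp: keys spanning_pairs_def)
    then show ?thesis by auto
  qed
  have kdim: "cdim Q = ?k" if "Q \<in> Poly_Mapping.keys ?X" for Q
    using that cells by (auto simp: cells_def)
  \<comment> \<open>Phrased by inclusion and dimension, this covers the non-empty faces in both the
    plain and the augmented complex.\<close>
  have even_link: "even (card {Q \<in> Poly_Mapping.keys ?X. F \<subseteq> Q \<and> cdim F = cdim Q - 1})"
    if F_L: "F \<in> ?L" for F
  proof -
    obtain \<aa> \<bb> where F: "F = coupled_cube n A B \<aa> \<bb>"
      and ab: "(\<aa>, \<bb>) \<in> spanning_pairs n A B \<Gamma>A \<Gamma>B"
      using F_L by (auto simp: coupled_link_eq[OF col])
    then have ab': "\<aa> \<in> \<Gamma>A" "\<bb> \<in> \<Gamma>B" "{1..n} \<subseteq> colours n A \<aa> \<union> colours n B \<bb>"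
      by (auto simp: spanning_pairs_def)
    show ?thesis
    proof (cases "cdim F = ?k - 1")
      case True
      let ?P = "{\<sigma> \<in> ?KA. \<aa> \<subseteq> \<sigma>} \<times> {\<sigma> \<in> ?KB. \<bb> \<subseteq> \<sigma>}"
      \<comment> \<open>Larger simplices keep the colours of \<aa> and \<bb>, so every choice of
        cofaces is spanning and the cofaces of the cube form a full product.\<close>
      have P_sp: "?P \<subseteq> spanning_pairs n A B ?KA ?KB"
      proof clarify
        fix \<sigma> \<tau> assume st: "\<sigma> \<in> ?KA" "\<aa> \<subseteq> \<sigma>" "\<tau> \<in> ?KB" "\<bb> \<subseteq> \<tau>"
        then have "{1..n} \<subseteq> colours n A \<sigma> \<union> colours n B \<tau>"
          using ab'(3) colours_mono[of \<aa> \<sigma> n A] colours_mono[of \<bb> \<tau> n B] by blast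
        then show "(\<sigma>, \<tau>) \<in> spanning_pairs n A B ?KA ?KB"
          using st by (simp add: spanning_pairs_def)
      qed
      have "{Q \<in> Poly_Mapping.keys ?X. F \<subseteq> Q \<and> cdim F = cdim Q - 1} =
          {Q \<in> Poly_Mapping.keys ?X. F \<subseteq> Q}"
        using kdim True by auto
      also have "\<dots> = ?cube ` {p \<in> spanning_pairs n A B ?KA ?KB. F \<subseteq> ?cube p}"
        unfolding keys by blast
      also have "{p \<in> spanning_pairs n A B ?KA ?KB. F \<subseteq> ?cube p} = ?P"
      proof -
        have "F \<subseteq> ?cube p \<longleftrightarrow> \<aa> \<subseteq> fst p \<and> \<bb> \<subseteq> snd p" for p
          unfolding F using coupled_cube_subset_iff[OF col ab'] by (simp add: case_prod_beta)
        moreover have "spanning_pairs n A B ?KA ?KB \<subseteq> ?KA \<times> ?KB"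
          by (auto simp: spanning_pairs_def)
        ultimately show ?thesis using P_sp by fastforce
      qed
      also have "card (?cube ` ?P) = card ?P"
        using P_sp sp_sub by (intro card_image inj_on_subset[OF inj]) blast
      also have "even \<dots>"
      proof (rule even_card_cofaces_pairs[OF _ _ \<Omega>])
        show "sdim \<aa> + sdim \<bb> = dA + dB - 1"
          using True cdim_coupled_cube[OF col ab] by (simp add: F sdim_def)
      qed (use coloured_complexD(1) col in blast)+
      finally show ?thesis .
    next
      case False
      then have "{Q \<in> Poly_Mapping.keys ?X. F \<subseteq> Q \<and> cdim F = cdim Q - 1} = {}"
        using kdim by fastforce
      then show ?thesis by (simp only: card.empty even_zero)
    qed
  qed
  have "?X \<in> cycles ?L cdim ?k"
    unfolding cycles_iff[OF finL]
  proof (intro conjI allI cells)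
    fix F
    show "even (card {Q \<in> Poly_Mapping.keys ?X. F \<in> facets ?L cdim Q})"
      using even_link by (cases "F \<in> ?L") (auto simp: facets_def)
  qed
  moreover have "?X \<in> cycles (insert {} ?L) cdim ?k" if "n \<ge> 1"
    unfolding cycles_iff[OF finite.insertI[OF finL]]
  proof (intro conjI allI)
    show "Poly_Mapping.keys ?X \<subseteq> cells (insert {} ?L) cdim ?k"
      using cells by (auto simp: cells_def)
    fix F
    let ?E = "{} :: (nat \<Rightarrow> 'a + 'b) set"
    have empty: "cdim ?E = -1" by (simp add: cdim_def)
    have "even (card {Q \<in> Poly_Mapping.keys ?X. ?E \<subseteq> Q \<and> cdim ?E = cdim Q - 1})"
    \<comment> \<open>The empty cube has dimension -1, so it is a facet of all cubes of the chain if
      \<open>?k = 0\<close> and of none otherwise. In the first case the parity of the spanning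
      pairs is needed, for which \<open>n \<ge> 1\<close> supplies the colour 1.\<close>
    proof (cases "?k = 0")
      case True
      then have "{Q \<in> Poly_Mapping.keys ?X. ?E \<subseteq> Q \<and> cdim ?E = cdim Q - 1} =
          ?cube ` spanning_pairs n A B ?KA ?KB"
        unfolding keys[symmetric] empty using kdim by auto
      then show ?thesis
        using even_card_spanning_pairs[OF col \<Omega>] True \<open>n \<ge> 1\<close>
        by (simp add: card_image inj_on_subset[OF inj sp_sub])
    next
      case False
      then have "{Q \<in> Poly_Mapping.keys ?X. ?E \<subseteq> Q \<and> cdim ?E = cdim Q - 1} = {}"
        unfolding empty using kdim by fastforce
      then show ?thesis by (simp only: card.empty even_zero)
    qed
    then show "even (card {Q \<in> Poly_Mapping.keys ?X. F \<in> facets (insert {} ?L) cdim Q})"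
      using even_link by (cases "F \<in> insert {} ?L") (auto simp: facets_def)
  qed
  ultimately show ?thesis using nonzero by blast
qed

end
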